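(* Let $t_0<t_1$ be fixed, let $\rho_0,\rho_1\in\mathcal{P}_2(\mathbb{R}^3)$, let $\varepsilon>0$, and let the gravitational potential $V$ (given by the formula in the context) take values in $(-\infty,0)$. Consider the Lambertian Schrödinger bridge problem (L-SBP) $$\underset{(\rho,\boldsymbol{v})\in\mathcal{P}_{01}\times\mathcal{V}}{\arg\inf}\ \int_{t_0}^{t_1}\int_{\mathbb{R}^3}\left(\frac12|\boldsymbol{v}|^2-V(\boldsymbol{r})\right)\rho(\boldsymbol{r},t)\,\mathrm{d}\boldsymbol{r}\,\mathrm{d}t\quad\text{subject to}\quad \frac{\partial\rho}{\partial t}+\nabla_{\boldsymbol{r}}\cdot(\rho\boldsymbol{v})=\varepsilon\Delta_{\boldsymbol{r}}\rho .$$ Let $(\rho_\varepsilon^{\mathrm{opt}},\psi_\varepsilon)$, with $\psi_\varepsilon$ once continuously differentiable in $t\in[t_0,t_1]$ and twice continuously differentiable in $\boldsymbol{r}\in\mathbb{R}^3$, be the solution of the associated first order optimality system $$\frac{\partial\psi_\varepsilon}{\partial t}+\frac12|\nabla_{\boldsymbol{r}}\psi_\varepsilon|^2+\varepsilon\Delta_{\boldsymbol{r}}\psi_\varepsilon=-V(\boldsymbol{r}),\qquad \frac{\partial\rho_\varepsilon^{\mathrm{opt}}}{\partial t}+\nabla_{\boldsymbol{r}}\cdot\left(\rho_\varepsilon^{\mathrm{opt}}\nabla_{\boldsymbol{r}}\psi_\varepsilon\right)=\varepsilon\Delta_{\boldsymbol{r}}\rho_\varepsilon^{\mathrm{opt}},$$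 with boundary conditions $\rho_\varepsilon^{\mathrm{opt}}(\cdot,t_0)=\rho_0$, $\rho_\varepsilon^{\mathrm{opt}}(\cdot,t_1)=\rho_1$ (here $\rho_\varepsilon^{\mathrm{opt}}$ is the optimal density of the L-SBP and the optimal control is $\boldsymbol{v}_\varepsilon^{\mathrm{opt}}=\nabla_{\boldsymbol{r}}\psi_\varepsilon$). Define $$\varphi_\varepsilon=\exp\left(\frac{\psi_\varepsilon}{2\varepsilon}\right),\qquad \widehat{\varphi}_\varepsilon=\rho_\varepsilon^{\mathrm{opt}}\exp\left(-\frac{\psi_\varepsilon}{2\varepsilon}\right).$$ Then the pair $(\widehat{\varphi}_\varepsilon,\varphi_\varepsilon)$ solves the system of forward and backward linear reaction-diffusion PDEs $$\frac{\partial\widehat{\varphi}_\varepsilon}{\partial t}=\left(\varepsilon\Delta_{\boldsymbol{r}}+\frac{1}{2\varepsilon}V(\boldsymbol{r})\right)\widehat{\varphi}_\varepsilon,\qquad \frac{\partial\varphi_\varepsilon}{\partial t}=-\left(\varepsilon\Delta_{\boldsymbol{r}}+\frac{1}{2\varepsilon}V(\boldsymbol{r})\right)\varphi_\varepsilon,$$ with coupled boundary conditions $$\widehat{\varphi}_\varepsilon(\cdot,t_0)\,\varphi_\varepsilon(\cdot,t_0)=\rho_0,\qquad \widehat{\varphi}_\varepsilon(\cdot,t_1)\,\varphi_\varepsilon(\cdot,t_1)=\rho_1 .$$ Moreover, for all $t\in[t_0,t_1]$, the minimizing pair for the L-SBP can be recovered as $$\rho_\varepsilon^{\mathrm{opt}}(\cdot,t)=\widehat{\varphi}_\varepsilon(\cdot,t)\,\varphi_\varepsilon(\cdot,t),\qquad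 \boldsymbol{v}_\varepsilon^{\mathrm{opt}}(\cdot,t)=2\varepsilon\nabla_{\boldsymbol{r}}\log\varphi_\varepsilon(\cdot,t).$$
   Context: $\mathcal{P}_2(\mathbb{R}^3)$ is the set of probability density functions $\rho:\mathbb{R}^3\to\mathbb{R}_{\ge 0}$ with $\int\rho\,\mathrm{d}\boldsymbol{r}=1$ and $\int|\boldsymbol{r}|^2\rho\,\mathrm{d}\boldsymbol{r}<\infty$. $\mathcal{P}_{01}$ is the collection of all PDF-valued trajectories $t\mapsto\rho(\cdot,t)\in\mathcal{P}_2(\mathbb{R}^3)$, continuous in $t\in[t_0,t_1]$, with $\rho(\cdot,t_0)=\rho_0$ and $\rho(\cdot,t_1)=\rho_1$. $\mathcal{V}$ is the set of Markovian control policies with finite energy: $\mathcal{V}=\{\boldsymbol{v}:\mathbb{R}^3\times[t_0,t_1]\to\mathbb{R}^3 \mid \int_{t_0}^{t_1}\int_{\mathbb{R}^3}|\boldsymbol{v}|^2\rho(\boldsymbol{r},t)\,\mathrm{d}\boldsymbol{r}\,\mathrm{d}t<\infty$ for all $\rho\in\mathcal{P}_2(\mathbb{R}^3)\}$. The map $(\rho_\varepsilon^{\mathrm{opt}},\psi_\varepsilon)\mapsto(\widehat{\varphi}_\varepsilon,\varphi_\varepsilon)$ is called the Hopf–Cole transform, and $\widehat{\varphi}_\varepsilon,\varphi_\varepsilon$ are called the Schrödinger factors. The potential $V$ is a negative, lower bounded, continuously differentiable function, of the form $$V(\boldsymbol{r})=-\frac{\mu}{|\boldsymbol{r}|}-\frac{\mu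 J_2R_{\mathrm{Earth}}^2}{2|\boldsymbol{r}|^3}\left(1-\frac{3z^2}{|\boldsymbol{r}|^2}\right),\qquad |\boldsymbol{r}|\ge R_{\mathrm{Earth}},\quad \boldsymbol{r}=(x,y,z)^\top,$$ with $\mu=398600.4415$, $J_2=1.08263\times10^{-3}$, $R_{\mathrm{Earth}}=6378.1363$. On $\mathbb{R}^3$, $V$ is regarded as a negative, lower bounded, continuously differentiable function given by this formula for $|\boldsymbol{r}|\ge R_{\mathrm{Earth}}$. *)

theory Defs
  imports "HOL-Analysis.Analysis"
begin

type_synonym R3 = "real ^ 3"

subsection \<open>Differential operators\<close>

definition partial :: "'a::euclidean_space \<Rightarrow> ('a \<Rightarrow> real) \<Rightarrow> 'a \<Rightarrow> real" where
  "partial b f x = deriv (\<lambda>s. f (x + s *\<^sub>R b)) 0"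

definition partial_differentiable :: "'a::euclidean_space \<Rightarrow> ('a \<Rightarrow> real) \<Rightarrow> 'a \<Rightarrow> bool" where
  "partial_differentiable b f x \<longleftrightarrow> (\<lambda>s. f (x + s *\<^sub>R b)) field_differentiable at 0"

definition grad :: "('a::euclidean_space \<Rightarrow> real) \<Rightarrow> 'a \<Rightarrow> 'a" where
  "grad f x = (\<Sum>b\<in>Basis. partial b f x *\<^sub>R b)"

definition divergence :: "('a::euclidean_space \<Rightarrow> 'a) \<Rightarrow> 'a \<Rightarrow> real" where
  "divergence F x = (\<Sum>b\<in>Basis. partial b (\<lambda>y. F y \<bullet> b) x)"

definition laplacian :: "('a::euclidean_space \<Rightarrow> real) \<Rightarrow> 'a \<Rightarrow> real" where
  "laplacian f x = (\<Sum>b\<in>Basis. partial b (partial b f) x)"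

text \<open>\<open>Ck k f\<close>: all partial derivatives of \<open>f\<close> of order up to \<open>k\<close> (mixed ones included)
  exist and are continuous on the whole space.\<close>

primrec Ck :: "nat \<Rightarrow> ('a::euclidean_space \<Rightarrow> real) \<Rightarrow> bool" where
  "Ck 0 f \<longleftrightarrow> continuous_on UNIV f"
| "Ck (Suc k) f \<longleftrightarrow>
     continuous_on UNIV f \<and>
     (\<forall>b\<in>Basis. (\<forall>x. partial_differentiable b f x) \<and> Ck k (partial b f))"

text \<open>Functions of \<open>(\<^bold>r, t)\<close> are curried, space first; only the times \<open>t \<in> [t0, t1]\<close> matter.
  Here: once continuously differentiable in \<open>t \<in> [t0, t1]\<close> (one-sidedly at the endpoints),
  and twice continuously differentiable in \<open>\<^bold>r\<close>.\<close>

definition C12 :: "real \<Rightarrow> real \<Rightarrow> (R3 \<Rightarrow> real \<Rightarrow> real) \<Rightarrow> bool" where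
  "C12 t0 t1 u \<longleftrightarrow>
     (\<forall>r. \<exists>D. continuous_on {t0..t1} D \<and>
        (\<forall>t\<in>{t0..t1}. (u r has_real_derivative D t) (at t within {t0..t1}))) \<and>
     (\<forall>t\<in>{t0..t1}. Ck 2 (\<lambda>r. u r t))"

subsection \<open>The potential\<close>

definition mu_Earth :: real where "mu_Earth = 398600.4415"
definition J2_Earth :: real where "J2_Earth = 1.08263 / 10 ^ 3"
definition R_Earth :: real where "R_Earth = 6378.1363"

definition gravitational_potential :: "(R3 \<Rightarrow> real) \<Rightarrow> bool" where
  "gravitational_potential V \<longleftrightarrow>
     (\<forall>r. V r < 0) \<and> bdd_below (range V) \<and> Ck 1 V \<and>
     (\<forall>r. norm r \<ge> R_Earth \<longrightarrow>
        V r = - mu_Earth / norm r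
              - (mu_Earth * J2_Earth * R_Earth ^ 2) / (2 * norm r ^ 3)
                * (1 - 3 * (r $ 3) ^ 2 / norm r ^ 2))"

subsection \<open>The Lambertian Schroedinger bridge problem\<close>

definition P2 :: "(R3 \<Rightarrow> real) set" where
  "P2 = {\<rho>. (\<forall>r. \<rho> r \<ge> 0) \<and> has_bochner_integral lborel \<rho> 1 \<and>
             integrable lborel (\<lambda>r. norm r ^ 2 * \<rho> r)}"

text \<open>Continuous \<open>P2\<close>-valued trajectories. Continuity is that of the Wasserstein-2 space:
  convergence of integrals of all continuous functions of at most quadratic growth. Joint
  measurability makes the space-time integrals meaningful.\<close>

definition P2_trajectory :: "real \<Rightarrow> real \<Rightarrow> (R3 \<Rightarrow> real \<Rightarrow> real) \<Rightarrow> bool" where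
  "P2_trajectory t0 t1 \<rho> \<longleftrightarrow>
     (\<forall>t\<in>{t0..t1}. (\<lambda>r. \<rho> r t) \<in> P2) \<and>
     set_borel_measurable lborel (UNIV \<times> {t0..t1}) (\<lambda>(r, t). \<rho> r t) \<and>
     (\<forall>f C. continuous_on UNIV f \<and> (\<forall>r. \<bar>f r\<bar> \<le> C * (1 + norm r ^ 2)) \<longrightarrow>
        continuous_on {t0..t1} (\<lambda>t. LINT r|lborel. f r * \<rho> r t))"

definition P01 :: "real \<Rightarrow> real \<Rightarrow> (R3 \<Rightarrow> real) \<Rightarrow> (R3 \<Rightarrow> real) \<Rightarrow> (R3 \<Rightarrow> real \<Rightarrow> real) set" where
  "P01 t0 t1 \<rho>0 \<rho>1 =
     {\<rho>. P2_trajectory t0 t1 \<rho> \<and> (\<forall>r. \<rho> r t0 = \<rho>0 r) \<and> (\<forall>r. \<rho> r t1 = \<rho>1 r)}"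

text \<open>Markovian policies whose energy is finite along every continuous \<open>P2\<close>-valued
  trajectory; the time-independent densities in \<open>P2\<close> are among these.\<close>

definition policies :: "real \<Rightarrow> real \<Rightarrow> (R3 \<Rightarrow> real \<Rightarrow> R3) set" where
  "policies t0 t1 =
     {v. set_borel_measurable lborel (UNIV \<times> {t0..t1}) (\<lambda>(r, t). v r t) \<and>
         (\<forall>\<rho>. P2_trajectory t0 t1 \<rho> \<longrightarrow>
            set_integrable lborel (UNIV \<times> {t0..t1}) (\<lambda>(r, t). norm (v r t) ^ 2 * \<rho> r t))}"

text \<open>A policy need not be differentiable, nor an admissible density, so the constraint
  \<open>\<partial>\<rho>/\<partial>t + \<nabla>\<cdot>(\<rho>v) = \<epsilon>\<Delta>\<rho>\<close> is imposed in the sense of distributions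
  on the open slab.\<close>

definition test_function :: "real \<Rightarrow> real \<Rightarrow> (R3 \<times> real \<Rightarrow> real) \<Rightarrow> bool" where
  "test_function t0 t1 \<eta> \<longleftrightarrow>
     (\<forall>k. Ck k \<eta>) \<and>
     (\<exists>K. compact K \<and> K \<subseteq> UNIV \<times> {t0<..<t1} \<and> (\<forall>p. p \<notin> K \<longrightarrow> \<eta> p = 0))"

definition weak_Fokker_Planck ::
    "real \<Rightarrow> real \<Rightarrow> real \<Rightarrow> (R3 \<Rightarrow> real \<Rightarrow> real) \<Rightarrow> (R3 \<Rightarrow> real \<Rightarrow> R3) \<Rightarrow> bool" where
  "weak_Fokker_Planck t0 t1 \<epsilon> \<rho> v \<longleftrightarrow>
     (\<forall>\<eta>. test_function t0 t1 \<eta> \<longrightarrow>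
        (LINT t:{t0..t1}|lborel. LINT r|lborel.
           (deriv (\<lambda>s. \<eta> (r, s)) t + v r t \<bullet> grad (\<lambda>x. \<eta> (x, t)) r
            + \<epsilon> * laplacian (\<lambda>x. \<eta> (x, t)) r) * \<rho> r t) = 0)"

definition LSBP_cost ::
    "real \<Rightarrow> real \<Rightarrow> (R3 \<Rightarrow> real) \<Rightarrow> (R3 \<Rightarrow> real \<Rightarrow> real) \<times> (R3 \<Rightarrow> real \<Rightarrow> R3) \<Rightarrow> real" where
  "LSBP_cost t0 t1 V = (\<lambda>(\<rho>, v).
     LINT t:{t0..t1}|lborel. LINT r|lborel. (1 / 2 * norm (v r t) ^ 2 - V r) * \<rho> r t)"

definition LSBP_feasible ::
    "real \<Rightarrow> real \<Rightarrow> real \<Rightarrow> (R3 \<Rightarrow> real) \<Rightarrow> (R3 \<Rightarrow> real) \<Rightarrow>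
     (R3 \<Rightarrow> real \<Rightarrow> real) \<times> (R3 \<Rightarrow> real \<Rightarrow> R3) \<Rightarrow> bool" where
  "LSBP_feasible t0 t1 \<epsilon> \<rho>0 \<rho>1 = (\<lambda>(\<rho>, v).
     \<rho> \<in> P01 t0 t1 \<rho>0 \<rho>1 \<and> v \<in> policies t0 t1 \<and> weak_Fokker_Planck t0 t1 \<epsilon> \<rho> v)"

definition LSBP_minimizer ::
    "real \<Rightarrow> real \<Rightarrow> real \<Rightarrow> (R3 \<Rightarrow> real) \<Rightarrow> (R3 \<Rightarrow> real) \<Rightarrow> (R3 \<Rightarrow> real) \<Rightarrow>
     (R3 \<Rightarrow> real \<Rightarrow> real) \<times> (R3 \<Rightarrow> real \<Rightarrow> R3) \<Rightarrow> bool" where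
  "LSBP_minimizer t0 t1 \<epsilon> V \<rho>0 \<rho>1 =
     is_arg_min (LSBP_cost t0 t1 V) (LSBP_feasible t0 t1 \<epsilon> \<rho>0 \<rho>1)"

subsection \<open>The PDE systems\<close>

text \<open>\<open>deriv\<close> is total, so existence of the derivatives entering an equation has to be
  asserted separately.\<close>

definition has_pde_derivatives :: "real \<Rightarrow> real \<Rightarrow> (R3 \<Rightarrow> real \<Rightarrow> real) \<Rightarrow> bool" where
  "has_pde_derivatives t0 t1 u \<longleftrightarrow>
     (\<forall>t\<in>{t0<..<t1}. \<forall>r.
        u r field_differentiable at t \<and>
        (\<forall>b\<in>Basis. partial_differentiable b (\<lambda>x. u x t) r \<and>
                   partial_differentiable b (partial b (\<lambda>x. u x t)) r))"

definition Hamilton_Jacobi_Bellman ::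
    "real \<Rightarrow> real \<Rightarrow> real \<Rightarrow> (R3 \<Rightarrow> real) \<Rightarrow> (R3 \<Rightarrow> real \<Rightarrow> real) \<Rightarrow> bool" where
  "Hamilton_Jacobi_Bellman t0 t1 \<epsilon> V \<psi> \<longleftrightarrow>
     has_pde_derivatives t0 t1 \<psi> \<and>
     (\<forall>t\<in>{t0<..<t1}. \<forall>r.
        deriv (\<psi> r) t + 1 / 2 * norm (grad (\<lambda>x. \<psi> x t) r) ^ 2 + \<epsilon> * laplacian (\<lambda>x. \<psi> x t) r
        = - V r)"

definition Fokker_Planck ::
    "real \<Rightarrow> real \<Rightarrow> real \<Rightarrow> (R3 \<Rightarrow> real \<Rightarrow> real) \<Rightarrow> (R3 \<Rightarrow> real \<Rightarrow> real) \<Rightarrow> bool" where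
  "Fokker_Planck t0 t1 \<epsilon> \<rho> \<psi> \<longleftrightarrow>
     has_pde_derivatives t0 t1 \<rho> \<and>
     (\<forall>t\<in>{t0<..<t1}. \<forall>r.
        deriv (\<rho> r) t + divergence (\<lambda>x. \<rho> x t *\<^sub>R grad (\<lambda>y. \<psi> y t) x) r
        = \<epsilon> * laplacian (\<lambda>x. \<rho> x t) r)"

definition forward_reaction_diffusion ::
    "real \<Rightarrow> real \<Rightarrow> real \<Rightarrow> (R3 \<Rightarrow> real) \<Rightarrow> (R3 \<Rightarrow> real \<Rightarrow> real) \<Rightarrow> bool" where
  "forward_reaction_diffusion t0 t1 \<epsilon> V u \<longleftrightarrow>
     has_pde_derivatives t0 t1 u \<and>
     (\<forall>t\<in>{t0<..<t1}. \<forall>r.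
        deriv (u r) t = \<epsilon> * laplacian (\<lambda>x. u x t) r + 1 / (2 * \<epsilon>) * V r * u r t)"

definition backward_reaction_diffusion ::
    "real \<Rightarrow> real \<Rightarrow> real \<Rightarrow> (R3 \<Rightarrow> real) \<Rightarrow> (R3 \<Rightarrow> real \<Rightarrow> real) \<Rightarrow> bool" where
  "backward_reaction_diffusion t0 t1 \<epsilon> V u \<longleftrightarrow>
     has_pde_derivatives t0 t1 u \<and>
     (\<forall>t\<in>{t0<..<t1}. \<forall>r.
        deriv (u r) t = - (\<epsilon> * laplacian (\<lambda>x. u x t) r + 1 / (2 * \<epsilon>) * V r * u r t))"

end

theory Submission
  imports Defs
begin

text \<open>
  The theorem is a pointwise computation with the optimality system. With \<open>c = 1 / (2 * \<epsilon>)\<close>,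
  both Schroedinger factors have the form
  \<open>g * exp (k * \<psi>)\<close>: the factor \<open>\<phi>\<close> with \<open>g = 1\<close>, \<open>k = c\<close>, and \<open>\<phi>_hat\<close> with
  \<open>g = \<rho>\<close>, \<open>k = - c\<close>. For such a function,
  \<open>\<Delta>(g * exp (k * \<psi>)) =
    (\<Delta>g + 2 * k * (\<nabla>g \<bullet> \<nabla>\<psi>) + k * g * \<Delta>\<psi> + k^2 * g * |\<nabla>\<psi>|^2) * exp (k * \<psi>)\<close>
  (\<open>laplacian_mult_exp\<close>), while the time derivative is
  \<open>(\<partial>g/\<partial>t + k * g * \<partial>\<psi>/\<partial>t) * exp (k * \<psi>)\<close>.

  For \<open>\<phi>\<close>, the value \<open>k = c\<close> is the one for which the quadratic term
  \<open>\<epsilon> * k^2 * |\<nabla>\<psi>|^2\<close> of the diffusion equals the term \<open>k * |\<nabla>\<psi>|^2 / 2\<close> that the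
  Hamilton-Jacobi-Bellman equation contributes through \<open>\<partial>\<psi>/\<partial>t\<close>. The nonlinearity
  cancels, the terms \<open>\<epsilon> * k * \<Delta>\<psi>\<close> of both sides cancel for every \<open>k\<close>, and
  the potential remains. For \<open>\<phi>_hat\<close>, the Fokker-Planck equation replaces
  \<open>\<partial>\<rho>/\<partial>t\<close> by \<open>\<epsilon> * \<Delta>\<rho> - \<nabla>\<rho> \<bullet> \<nabla>\<psi> - \<rho> * \<Delta>\<psi>\<close>
  (\<open>divergence_scaleR_grad\<close>). As \<open>2 * \<epsilon> * k = - 1\<close>, the drift is the cross term of
  \<open>\<epsilon> * \<Delta>\<phi>_hat\<close>; the term \<open>- \<rho> * \<Delta>\<psi>\<close> splits into two halves, one produced by
  \<open>\<epsilon> * \<Delta>\<phi>_hat\<close> and one cancelled by the Hamilton-Jacobi-Bellman equation.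
  The quadratic terms again agree, now because \<open>\<epsilon> * k^2 = - k / 2\<close>.

  The remaining claims hold because the two exponentials are inverse to each other and
  \<open>\<psi> = 2 * \<epsilon> * ln \<phi>\<close>.
\<close>

lemma partial_differentiable_iff:
  "partial_differentiable b f x \<longleftrightarrow>
     ((\<lambda>s. f (x + s *\<^sub>R b)) has_real_derivative partial b f x) (at 0)"
  unfolding partial_differentiable_def partial_def
  using DERIV_deriv_iff_field_differentiable field_differentiable_def by blast

lemma has_partialI:
  assumes "((\<lambda>s. f (x + s *\<^sub>R b)) has_real_derivative D) (at 0)"
  shows "partial_differentiable b f x" and "partial b f x = D"
  using assms DERIV_imp_deriv
  unfolding partial_differentiable_def partial_def field_differentiable_def by blast+

lemma partial_mult:
  assumes "partial_differentiable b f x" "partial_differentiable b g x"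
  shows "partial b (\<lambda>y. f y * g y) x = partial b f x * g x + f x * partial b g x"
proof (rule has_partialI(2))
  show "((\<lambda>s. f (x + s *\<^sub>R b) * g (x + s *\<^sub>R b)) has_real_derivative
          partial b f x * g x + f x * partial b g x) (at 0)"
    using DERIV_mult[OF assms[unfolded partial_differentiable_iff]]
    by (simp add: algebra_simps)
qed

lemma partial_cmult:
  assumes "partial_differentiable b f x"
  shows "partial b (\<lambda>y. k * f y) x = k * partial b f x"
  by (rule has_partialI(2))
     (rule DERIV_cmult[OF assms[unfolded partial_differentiable_iff]])

lemma partial_mult_exp:
  assumes "partial_differentiable b f x" "partial_differentiable b g x"
  shows "partial_differentiable b (\<lambda>y. g y * exp (k * f y)) x"
    and "partial b (\<lambda>y. g y * exp (k * f y)) x =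
           (partial b g x + k * (g x * partial b f x)) * exp (k * f x)"
proof -
  note [derivative_intros] = assms[unfolded partial_differentiable_iff]
  have "((\<lambda>s. g (x + s *\<^sub>R b) * exp (k * f (x + s *\<^sub>R b))) has_real_derivative
          (partial b g x + k * (g x * partial b f x)) * exp (k * f x)) (at 0)"
    by (auto intro!: derivative_eq_intros simp: algebra_simps)
  from has_partialI[where f = "\<lambda>y. g y * exp (k * f y)", OF this]
  show "partial_differentiable b (\<lambda>y. g y * exp (k * f y)) x"
    and "partial b (\<lambda>y. g y * exp (k * f y)) x =
           (partial b g x + k * (g x * partial b f x)) * exp (k * f x)" .
qed

definition has_laplacian_partials :: "('a::euclidean_space \<Rightarrow> real) \<Rightarrow> bool" where
  "has_laplacian_partials f \<longleftrightarrow>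
     (\<forall>x. \<forall>b\<in>Basis. partial_differentiable b f x \<and> partial_differentiable b (partial b f) x)"

lemma has_laplacian_partialsD:
  assumes "has_laplacian_partials f" "b \<in> Basis"
  shows "partial_differentiable b f x" and "partial_differentiable b (partial b f) x"
  using assms unfolding has_laplacian_partials_def by blast+

lemma partial_const: "partial_differentiable b (\<lambda>y. k) x" "partial b (\<lambda>y. k) = (\<lambda>x. 0)"
  using has_partialI[where f = "\<lambda>y. k", OF DERIV_const]
  by (auto simp: fun_eq_iff)

lemma const_second_order:
  "has_laplacian_partials (\<lambda>x. k)" "grad (\<lambda>x. k) x = 0" "laplacian (\<lambda>x. k) x = 0"
  unfolding has_laplacian_partials_def grad_def laplacian_def
  by (simp_all add: partial_const)

lemma grad_inner_Basis: "b \<in> Basis \<Longrightarrow> grad f x \<bullet> b = partial b f x"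
  unfolding grad_def by simp

lemma grad_inner_grad: "grad f x \<bullet> grad g x = (\<Sum>b\<in>Basis. partial b f x * partial b g x)"
  by (subst euclidean_inner) (simp add: grad_inner_Basis)

lemma grad_cmult:
  assumes "\<And>b. b \<in> Basis \<Longrightarrow> partial_differentiable b f x"
  shows "grad (\<lambda>y. k * f y) x = k *\<^sub>R grad f x"
  unfolding grad_def scaleR_sum_right
  by (intro sum.cong) (simp_all add: partial_cmult assms)

text \<open>Only the pure second partials of \<open>f\<close> occur on the left, since the component of
  \<open>grad f\<close> along \<open>b\<close> is differentiated along the same \<open>b\<close>; this is what makes
  the Laplacian of \<open>f\<close> appear.\<close>

lemma divergence_scaleR_grad:
  assumes f: "has_laplacian_partials f" and g: "has_laplacian_partials g"
  shows "divergence (\<lambda>y. g y *\<^sub>R grad f y) x = grad g x \<bullet> grad f x + g x * laplacian f x"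
proof -
  have "divergence (\<lambda>y. g y *\<^sub>R grad f y) x
          = (\<Sum>b\<in>Basis. partial b (\<lambda>y. g y * partial b f y) x)"
    unfolding divergence_def by (intro sum.cong) (simp_all add: grad_inner_Basis)
  also have "\<dots> = (\<Sum>b\<in>Basis. partial b g x * partial b f x + g x * partial b (partial b f) x)"
    by (intro sum.cong refl partial_mult has_laplacian_partialsD[OF f]
          has_laplacian_partialsD[OF g])
  finally show ?thesis
    unfolding grad_inner_grad laplacian_def by (simp add: sum.distrib sum_distrib_left)
qed

text \<open>The first partial of \<open>g * exp (k * f)\<close> is again a product with the same exponential,
  so the first-order rule \<open>partial_mult_exp\<close> can be applied twice.\<close>

lemma laplacian_mult_exp:
  assumes f: "has_laplacian_partials f" and g: "has_laplacian_partials g"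
  shows "has_laplacian_partials (\<lambda>y. g y * exp (k * f y))"
    and "laplacian (\<lambda>y. g y * exp (k * f y)) x =
           (laplacian g x + 2 * k * (grad g x \<bullet> grad f x) + k * g x * laplacian f x
            + k^2 * g x * norm (grad f x)^2) * exp (k * f x)"
proof -
  let ?u = "\<lambda>y. g y * exp (k * f y)"
  define h where "h b y = partial b g y + k * (g y * partial b f y)" for b y
  have pu: "partial b ?u = (\<lambda>y. h b y * exp (k * f y))" if "b \<in> Basis" for b
    unfolding h_def
    using partial_mult_exp(2)[OF has_laplacian_partialsD(1)[OF f that]
        has_laplacian_partialsD(1)[OF g that]] by blast
  have h: "partial_differentiable b (h b) y"
      "partial b (h b) y = partial b (partial b g) y
         + k * (partial b g y * partial b f y + g y * partial b (partial b f) y)"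
    if "b \<in> Basis" for b y
  proof -
    note [derivative_intros] =
      has_laplacian_partialsD[OF f that, of y, unfolded partial_differentiable_iff]
      has_laplacian_partialsD[OF g that, of y, unfolded partial_differentiable_iff]
    have "((\<lambda>s. h b (y + s *\<^sub>R b)) has_real_derivative partial b (partial b g) y
         + k * (partial b g y * partial b f y + g y * partial b (partial b f) y)) (at 0)"
      unfolding h_def by (auto intro!: derivative_eq_intros simp: algebra_simps)
    from has_partialI[OF this]
    show "partial_differentiable b (h b) y"
      "partial b (h b) y = partial b (partial b g) y
         + k * (partial b g y * partial b f y + g y * partial b (partial b f) y)" .
  qed
  show "has_laplacian_partials ?u"
    unfolding has_laplacian_partials_def
    by (auto simp: pu intro!: partial_mult_exp(1) h has_laplacian_partialsD[OF f]
          has_laplacian_partialsD[OF g])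
  have second: "partial b (partial b ?u) x =
      (partial b (partial b g) x + 2 * k * (partial b g x * partial b f x)
        + k * g x * partial b (partial b f) x
        + k^2 * g x * (partial b f x * partial b f x)) * exp (k * f x)" if "b \<in> Basis" for b
    unfolding pu[OF that]
      partial_mult_exp(2)[OF has_laplacian_partialsD(1)[OF f that] h(1)[OF that]]
      h(2)[OF that]
    by (simp add: h_def algebra_simps power2_eq_square)
  show "laplacian ?u x =
           (laplacian g x + 2 * k * (grad g x \<bullet> grad f x) + k * g x * laplacian f x
            + k^2 * g x * norm (grad f x)^2) * exp (k * f x)"
    unfolding power2_norm_eq_inner[of "grad f x"] grad_inner_grad laplacian_def
    by (simp add: second sum.distrib sum_distrib_left sum_distrib_right distrib_right)
qed

lemma has_pde_derivatives_iff:
  "has_pde_derivatives t0 t1 u \<longleftrightarrow>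
     (\<forall>t\<in>{t0<..<t1}. (\<forall>r. u r field_differentiable at t) \<and>
        has_laplacian_partials (\<lambda>x. u x t))"
  unfolding has_pde_derivatives_def has_laplacian_partials_def by blast

text \<open>The common calculus of both Schroedinger factors. The representation of \<open>u\<close> is
  known only for times in the slab, which suffices because interior times have a neighbourhood
  inside it.\<close>

lemma exponential_factor_derivatives:
  assumes f: "has_pde_derivatives t0 t1 f" and g: "has_pde_derivatives t0 t1 g"
    and u: "\<And>r t. t \<in> {t0..t1} \<Longrightarrow> u r t = g r t * exp (k * f r t)"
  shows "has_pde_derivatives t0 t1 u"
    and "t \<in> {t0<..<t1} \<Longrightarrow>
           deriv (u r) t = (deriv (g r) t + k * g r t * deriv (f r) t) * exp (k * f r t)"
    and "t \<in> {t0<..<t1} \<Longrightarrow>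
           laplacian (\<lambda>x. u x t) r =
             (laplacian (\<lambda>x. g x t) r
              + 2 * k * (grad (\<lambda>x. g x t) r \<bullet> grad (\<lambda>x. f x t) r)
              + k * g r t * laplacian (\<lambda>x. f x t) r
              + k^2 * g r t * norm (grad (\<lambda>x. f x t) r)^2) * exp (k * f r t)"
proof -
  have time: "(u r has_real_derivative
      (deriv (g r) t + k * g r t * deriv (f r) t) * exp (k * f r t)) (at t)"
    if t: "t \<in> {t0<..<t1}" for r t
  proof -
    have [derivative_intros]: "(f r has_real_derivative deriv (f r) t) (at t)"
        "(g r has_real_derivative deriv (g r) t) (at t)"
      using f g t unfolding has_pde_derivatives_iff
      by (auto simp: DERIV_deriv_iff_field_differentiable)
    have "((\<lambda>s. g r s * exp (k * f r s)) has_real_derivative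
        (deriv (g r) t + k * g r t * deriv (f r) t) * exp (k * f r t)) (at t)"
      by (auto intro!: derivative_eq_intros simp: algebra_simps)
    then show ?thesis
      by (rule has_field_derivative_transform_within_open[where S = "{t0<..<t1}"])
         (use t u in auto)
  qed
  have space: "(\<lambda>x. u x t) = (\<lambda>x. g x t * exp (k * f x t))"
      "has_laplacian_partials (\<lambda>x. f x t)" "has_laplacian_partials (\<lambda>x. g x t)"
    if "t \<in> {t0<..<t1}" for t
    using that u f g unfolding has_pde_derivatives_iff by auto
  show "has_pde_derivatives t0 t1 u"
    unfolding has_pde_derivatives_iff
  proof (intro ballI conjI allI)
    fix t r assume t: "t \<in> {t0<..<t1}"
    show "u r field_differentiable at t"
      unfolding field_differentiable_def by (rule exI, rule time[OF t])
    show "has_laplacian_partials (\<lambda>x. u x t)"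
      unfolding space(1)[OF t] by (rule laplacian_mult_exp(1)[OF space(2,3)[OF t]])
  qed
  show "deriv (u r) t = (deriv (g r) t + k * g r t * deriv (f r) t) * exp (k * f r t)"
    if "t \<in> {t0<..<t1}"
    by (rule DERIV_imp_deriv[OF time[OF that]])
  show "laplacian (\<lambda>x. u x t) r =
             (laplacian (\<lambda>x. g x t) r
              + 2 * k * (grad (\<lambda>x. g x t) r \<bullet> grad (\<lambda>x. f x t) r)
              + k * g r t * laplacian (\<lambda>x. f x t) r
              + k^2 * g r t * norm (grad (\<lambda>x. f x t) r)^2) * exp (k * f r t)"
    if "t \<in> {t0<..<t1}"
    unfolding space(1)[OF that]
    by (rule laplacian_mult_exp(2)[OF space(2,3)[OF that]])
qed

lemma backward_Schroedinger_factor: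
  assumes "\<epsilon> > 0"
    and hjb: "Hamilton_Jacobi_Bellman t0 t1 \<epsilon> V \<psi>"
    and \<phi>: "\<And>r t. t \<in> {t0..t1} \<Longrightarrow> \<phi> r t = exp (\<psi> r t / (2 * \<epsilon>))"
  shows "backward_reaction_diffusion t0 t1 \<epsilon> V \<phi>"
proof -
  define k where "k = 1 / (2 * \<epsilon>)"
  have k: "2 * \<epsilon> * k = 1" using \<open>\<epsilon> > 0\<close> by (simp add: k_def)
  have \<psi>: "has_pde_derivatives t0 t1 \<psi>"
    using hjb unfolding Hamilton_Jacobi_Bellman_def by blast
  have one: "has_pde_derivatives t0 t1 (\<lambda>_ _. 1)"
    unfolding has_pde_derivatives_iff by (simp add: const_second_order)
  have u: "\<phi> r t = 1 * exp (k * \<psi> r t)" if "t \<in> {t0..t1}" for r t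
    using \<phi>[OF that] by (simp add: k_def)
  note D = exponential_factor_derivatives[where u = \<phi> and k = k, OF \<psi> one u]
  have "deriv (\<phi> r) t = - (\<epsilon> * laplacian (\<lambda>x. \<phi> x t) r + 1 / (2 * \<epsilon>) * V r * \<phi> r t)"
    if t: "t \<in> {t0<..<t1}" for r t
  proof -
    define L where "L = laplacian (\<lambda>x. \<psi> x t) r"
    define N where "N = norm (grad (\<lambda>x. \<psi> x t) r) ^ 2"
    define E where "E = exp (k * \<psi> r t)"
    have H: "deriv (\<psi> r) t = - V r - 1 / 2 * N - \<epsilon> * L"
      using hjb[unfolded Hamilton_Jacobi_Bellman_def, THEN conjunct2,
          rule_format, OF t, of r] unfolding L_def N_def by linarith
    have "deriv (\<phi> r) t = k * deriv (\<psi> r) t * E"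
      using D(2)[OF _ t] by (simp add: E_def)
    moreover have "laplacian (\<lambda>x. \<phi> x t) r = (k * L + k^2 * N) * E"
      using D(3)[OF _ t] by (simp add: const_second_order E_def L_def N_def)
    moreover have "\<phi> r t = E" using u t by (simp add: E_def)
    moreover have "k * (- V r - 1 / 2 * N - \<epsilon> * L) * E
        = - (\<epsilon> * ((k * L + k^2 * N) * E) + k * V r * E)"
      using k by algebra
    ultimately show ?thesis unfolding H k_def[symmetric] by simp
  qed
  with D(1) show ?thesis unfolding backward_reaction_diffusion_def by blast
qed

lemma forward_Schroedinger_factor:
  assumes "\<epsilon> > 0"
    and hjb: "Hamilton_Jacobi_Bellman t0 t1 \<epsilon> V \<psi>"
    and fp: "Fokker_Planck t0 t1 \<epsilon> \<rho> \<psi>"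
    and \<phi>_hat: "\<And>r t. t \<in> {t0..t1} \<Longrightarrow> \<phi>_hat r t = \<rho> r t * exp (- \<psi> r t / (2 * \<epsilon>))"
  shows "forward_reaction_diffusion t0 t1 \<epsilon> V \<phi>_hat"
proof -
  define k where "k = 1 / (2 * \<epsilon>)"
  have k: "2 * \<epsilon> * k = 1" using \<open>\<epsilon> > 0\<close> by (simp add: k_def)
  have \<psi>: "has_pde_derivatives t0 t1 \<psi>"
    using hjb unfolding Hamilton_Jacobi_Bellman_def by blast
  have \<rho>: "has_pde_derivatives t0 t1 \<rho>"
    using fp unfolding Fokker_Planck_def by blast
  have u: "\<phi>_hat r t = \<rho> r t * exp (- k * \<psi> r t)" if "t \<in> {t0..t1}" for r t
    using \<phi>_hat[OF that] by (simp add: k_def)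
  note D = exponential_factor_derivatives[where u = \<phi>_hat and k = "- k", OF \<psi> \<rho> u]
  have "deriv (\<phi>_hat r) t
      = \<epsilon> * laplacian (\<lambda>x. \<phi>_hat x t) r + 1 / (2 * \<epsilon>) * V r * \<phi>_hat r t"
    if t: "t \<in> {t0<..<t1}" for r t
  proof -
    define L where "L = laplacian (\<lambda>x. \<psi> x t) r"
    define N where "N = norm (grad (\<lambda>x. \<psi> x t) r) ^ 2"
    define M where "M = laplacian (\<lambda>x. \<rho> x t) r"
    define P where "P = grad (\<lambda>x. \<rho> x t) r \<bullet> grad (\<lambda>x. \<psi> x t) r"
    define E where "E = exp (- k * \<psi> r t)"
    have H: "deriv (\<psi> r) t = - V r - 1 / 2 * N - \<epsilon> * L"
      using hjb[unfolded Hamilton_Jacobi_Bellman_def, THEN conjunct2,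
          rule_format, OF t, of r] unfolding L_def N_def by linarith
    have "divergence (\<lambda>x. \<rho> x t *\<^sub>R grad (\<lambda>y. \<psi> y t) x) r = P + \<rho> r t * L"
      unfolding P_def L_def
      using \<psi> \<rho> t by (intro divergence_scaleR_grad) (auto simp: has_pde_derivatives_iff)
    then have F: "deriv (\<rho> r) t = \<epsilon> * M - P - \<rho> r t * L"
      using fp[unfolded Fokker_Planck_def, THEN conjunct2, rule_format, OF t, of r]
      unfolding M_def by linarith
    have "deriv (\<phi>_hat r) t = (deriv (\<rho> r) t - k * \<rho> r t * deriv (\<psi> r) t) * E"
      using D(2)[OF _ t] by (simp add: E_def)
    moreover have "laplacian (\<lambda>x. \<phi>_hat x t) r
        = (M - 2 * k * P - k * \<rho> r t * L + k^2 * \<rho> r t * N) * E"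
      using D(3)[OF _ t] by (simp add: E_def L_def N_def M_def P_def)
    moreover have "\<phi>_hat r t = \<rho> r t * E" using u t by (simp add: E_def)
    moreover have
      "(\<epsilon> * M - P - \<rho> r t * L - k * \<rho> r t * (- V r - 1 / 2 * N - \<epsilon> * L)) * E
        = \<epsilon> * ((M - 2 * k * P - k * \<rho> r t * L + k^2 * \<rho> r t * N) * E)
          + k * V r * (\<rho> r t * E)"
      using k by algebra
    ultimately show ?thesis unfolding H F k_def[symmetric] by simp
  qed
  with D(1) show ?thesis unfolding forward_reaction_diffusion_def by blast
qed

theorem theorem4p7:
  fixes t0 t1 \<epsilon> :: real
    and \<rho>0 \<rho>1 V :: "real ^ 3 \<Rightarrow> real"
    and \<rho>_opt \<psi> \<phi> \<phi>_hat :: "real ^ 3 \<Rightarrow> real \<Rightarrow> real"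
    and v_opt :: "real ^ 3 \<Rightarrow> real \<Rightarrow> real ^ 3"
  assumes "t0 < t1"
    and "\<rho>0 \<in> P2" and "\<rho>1 \<in> P2"
    and "\<epsilon> > 0"
    and "gravitational_potential V"
    and "C12 t0 t1 \<psi>"
    and "Hamilton_Jacobi_Bellman t0 t1 \<epsilon> V \<psi>"
    and "Fokker_Planck t0 t1 \<epsilon> \<rho>_opt \<psi>"
    and "\<And>r. \<rho>_opt r t0 = \<rho>0 r" and "\<And>r. \<rho>_opt r t1 = \<rho>1 r"
    and "LSBP_minimizer t0 t1 \<epsilon> V \<rho>0 \<rho>1 (\<rho>_opt, v_opt)"
    and "\<And>r t. t \<in> {t0..t1} \<Longrightarrow> v_opt r t = grad (\<lambda>x. \<psi> x t) r"
    and "\<And>r t. t \<in> {t0..t1} \<Longrightarrow> \<phi> r t = exp (\<psi> r t / (2 * \<epsilon>))"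
    and "\<And>r t. t \<in> {t0..t1} \<Longrightarrow> \<phi>_hat r t = \<rho>_opt r t * exp (- \<psi> r t / (2 * \<epsilon>))"
  shows
    "forward_reaction_diffusion t0 t1 \<epsilon> V \<phi>_hat \<and>
     backward_reaction_diffusion t0 t1 \<epsilon> V \<phi> \<and>
     (\<forall>r. \<phi>_hat r t0 * \<phi> r t0 = \<rho>0 r) \<and>
     (\<forall>r. \<phi>_hat r t1 * \<phi> r t1 = \<rho>1 r) \<and>
     (\<forall>t\<in>{t0..t1}. \<forall>r. \<rho>_opt r t = \<phi>_hat r t * \<phi> r t) \<and>
     (\<forall>t\<in>{t0..t1}. \<forall>r. v_opt r t = (2 * \<epsilon>) *\<^sub>R grad (\<lambda>x. ln (\<phi> x t)) r)"
proof (intro conjI ballI allI)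
  show "forward_reaction_diffusion t0 t1 \<epsilon> V \<phi>_hat"
    by (rule forward_Schroedinger_factor[OF assms(4,7,8,14)])
  show "backward_reaction_diffusion t0 t1 \<epsilon> V \<phi>"
    by (rule backward_Schroedinger_factor[OF assms(4,7,13)])
  have factor: "\<rho>_opt r t = \<phi>_hat r t * \<phi> r t" if "t \<in> {t0..t1}" for r t
    using assms(13,14)[OF that] by (simp add: exp_minus field_simps)
  show "\<phi>_hat r t0 * \<phi> r t0 = \<rho>0 r" "\<phi>_hat r t1 * \<phi> r t1 = \<rho>1 r" for r
    using factor[of t0] factor[of t1] assms(1,9,10) by simp_all
  show "\<rho>_opt r t = \<phi>_hat r t * \<phi> r t" if "t \<in> {t0..t1}" for r t
    by (rule factor[OF that])
  show "v_opt r t = (2 * \<epsilon>) *\<^sub>R grad (\<lambda>x. ln (\<phi> x t)) r" if t: "t \<in> {t0..t1}" for r t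
  proof -
    \<comment> \<open>At the endpoints \<open>t0\<close> and \<open>t1\<close>, spatial differentiability of \<open>\<psi>\<close> comes from its
      \<open>C12\<close> regularity; the differential equations hold only at interior times.\<close>
    have diff: "partial_differentiable b (\<lambda>x. \<psi> x t) r" if "b \<in> Basis" for b
      using assms(6) t that unfolding C12_def by (auto simp: numeral_2_eq_2)
    have "(\<lambda>x. ln (\<phi> x t)) = (\<lambda>x. 1 / (2 * \<epsilon>) * \<psi> x t)"
      using assms(13)[OF t] by simp
    then have "grad (\<lambda>x. ln (\<phi> x t)) r = (1 / (2 * \<epsilon>)) *\<^sub>R grad (\<lambda>x. \<psi> x t) r"
      by (simp only: grad_cmult[OF diff])
    with assms(4) assms(12)[OF t] show ?thesis by simp
  qed
qed

end
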